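(* Let $X$ be a measurable space and $Y=\{-1,1\}$. For every probability distribution $P$ on $X\times Y$, every real $\epsilon$, and every pair of classifiers $f,\tilde f: X\to\mathbb{R}$ with $\|f-\tilde f\|_\infty\le \epsilon$, $$\mathrm{Risk}_{01}(P,\tilde f)\le \mathrm{Risk}_{\ell_\epsilon}(P,f).$$
   Context: A classifier is a bounded measurable function $f:X\to\mathbb{R}$, and $\|f-\tilde f\|_\infty=\sup_{x\in X}|f(x)-\tilde f(x)|$. For a loss $\ell:Y\times\mathbb{R}\to\mathbb{R}$, $\mathrm{Risk}_\ell(P,f)=\mathbb{E}_{(x,y)\sim P}\,\ell(y,f(x))$. The misclassification loss is $\ell_{01}(y,v)=1$ if $yv\le 0$ and $0$ otherwise (so $\ell_{01}(y,0)=1$), and $\mathrm{Risk}_{01}=\mathrm{Risk}_{\ell_{01}}$. The margin loss at margin $\gamma$ is $\ell_\gamma(y,v)=1$ if $yv\le\gamma$ and $0$ otherwise. *)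

theory Defs
  imports "HOL-Probability.Probability"
begin

definition label_space :: "real measure" where
  "label_space = count_space {-1, 1}"

definition classifier :: "'a measure \<Rightarrow> ('a \<Rightarrow> real) \<Rightarrow> bool" where
  "classifier X f \<longleftrightarrow> f \<in> borel_measurable X \<and> bounded (f ` space X)"

text \<open>The supremum of reals is meaningful here when \<open>X\<close> is nonempty and \<open>f\<close>, \<open>g\<close> are
  bounded on it.\<close>

definition sup_dist :: "'a measure \<Rightarrow> ('a \<Rightarrow> real) \<Rightarrow> ('a \<Rightarrow> real) \<Rightarrow> real" where
  "sup_dist X f g = (SUP x\<in>space X. \<bar>f x - g x\<bar>)"

definition risk ::
  "(real \<Rightarrow> real \<Rightarrow> real) \<Rightarrow> ('a \<times> real) measure \<Rightarrow> ('a \<Rightarrow> real) \<Rightarrow> real" where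
  "risk l P f = prob_space.expectation P (\<lambda>(x, y). l y (f x))"

definition misclassification_loss :: "real \<Rightarrow> real \<Rightarrow> real" where
  "misclassification_loss y v = (if y * v \<le> 0 then 1 else 0)"

definition margin_loss :: "real \<Rightarrow> real \<Rightarrow> real \<Rightarrow> real" where
  "margin_loss \<gamma> y v = (if y * v \<le> \<gamma> then 1 else 0)"

definition risk01 :: "('a \<times> real) measure \<Rightarrow> ('a \<Rightarrow> real) \<Rightarrow> real" where
  "risk01 = risk misclassification_loss"

end

theory Submission
  imports Defs
begin

text \<open>The losses compare pointwise. Since a label \<open>y\<close> is 1 or -1,
  \<open>y * f x\<close> and \<open>y * f' x\<close> differ by at most \<epsilon>, so
  \<open>y * f' x\<close> \<le> 0 forces \<open>y * f x\<close> \<le> \<epsilon>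
  (\<open>misclassification_loss_le_margin_loss\<close>). Monotonicity of expectation then gives the
  claim, with \<open>integrable_margin_loss\<close> covering both integrands.\<close>

text \<open>Boundedness of both classifiers makes the real supremum a genuine upper bound.\<close>

lemma classifier_diff_le_sup_dist:
  assumes "classifier X f" and "classifier X g" and "x \<in> space X"
  shows "\<bar>f x - g x\<bar> \<le> sup_dist X f g"
proof -
  obtain a b where "\<And>x. x \<in> space X \<Longrightarrow> \<bar>f x\<bar> \<le> a" "\<And>x. x \<in> space X \<Longrightarrow> \<bar>g x\<bar> \<le> b"
    using assms(1,2) by (auto simp: classifier_def bounded_iff)
  then have "bdd_above ((\<lambda>x. \<bar>f x - g x\<bar>) ` space X)"
    by (intro bdd_aboveI2[where M = "a + b"]) (smt (verit))
  then show ?thesis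
    unfolding sup_dist_def by (rule cSUP_upper[OF assms(3)])
qed

lemma misclassification_loss_le_margin_loss:
  assumes "y \<in> {-1, 1}" and "\<bar>v - w\<bar> \<le> \<epsilon>"
  shows "misclassification_loss y w \<le> margin_loss \<epsilon> y v"
  using assms by (auto simp: misclassification_loss_def margin_loss_def)

text \<open>Lets a single integrability lemma serve both losses.\<close>

lemma misclassification_loss_eq_margin_loss: "misclassification_loss = margin_loss 0"
  by (simp add: fun_eq_iff misclassification_loss_def margin_loss_def)

text \<open>A measurable function with values in {0, 1} is integrable on a probability space.
  Monotonicity needs this, as a non-integrable function has integral 0 by convention.\<close>

lemma integrable_margin_loss:
  assumes "prob_space P" and sets_P: "sets P = sets (X \<Otimes>\<^sub>M label_space)"
    and "f \<in> borel_measurable X"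
  shows "integrable P (\<lambda>(x, y). margin_loss \<gamma> y (f x))"
proof -
  interpret prob_space P by fact
  have [measurable]: "f \<in> borel_measurable X" by fact
  \<comment> \<open>Labels carry the discrete sigma-algebra, so their inclusion into the reals is
    measurable.\<close>
  have [measurable]: "(\<lambda>y. y) \<in> borel_measurable label_space"
    by (simp add: label_space_def)
  have "(\<lambda>(x, y). margin_loss \<gamma> y (f x)) \<in> borel_measurable (X \<Otimes>\<^sub>M label_space)"
    unfolding margin_loss_def by measurable
  then have "(\<lambda>(x, y). margin_loss \<gamma> y (f x)) \<in> borel_measurable P"
    by (simp cong: measurable_cong_sets add: sets_P)
  then show ?thesis
    by (intro integrable_const_bound[where B = 1]) (auto simp: margin_loss_def)
qed

theorem theorem7:
  fixes X :: "'a measure"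
    and P :: "('a \<times> real) measure"
    and \<epsilon> :: real
    and f f' :: "'a \<Rightarrow> real"
  assumes "prob_space P"
    and "sets P = sets (X \<Otimes>\<^sub>M label_space)"
    and "classifier X f"
    and "classifier X f'"
    and "sup_dist X f f' \<le> \<epsilon>"
  shows "risk01 P f' \<le> risk (margin_loss \<epsilon>) P f"
proof -
  \<comment> \<open>The sigma-algebra determines the space, so every point of \<open>P\<close>, not
    just almost every one, has a label 1 or -1.\<close>
  have "space P = space X \<times> {-1, 1}"
    using sets_eq_imp_space_eq[OF assms(2)] by (simp add: space_pair_measure label_space_def)
  moreover have "\<bar>f x - f' x\<bar> \<le> \<epsilon>" if "x \<in> space X" for x
    using classifier_diff_le_sup_dist[OF assms(3,4) that] assms(5) by linarith
  ultimately have "misclassification_loss y (f' x) \<le> margin_loss \<epsilon> y (f x)"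
    if "(x, y) \<in> space P" for x y
    using that by (intro misclassification_loss_le_margin_loss) auto
  moreover have "integrable P (\<lambda>(x, y). misclassification_loss y (f' x))"
    "integrable P (\<lambda>(x, y). margin_loss \<epsilon> y (f x))"
    using integrable_margin_loss[OF assms(1,2)] assms(3,4)
    by (auto simp: classifier_def misclassification_loss_eq_margin_loss)
  ultimately show ?thesis
    unfolding risk01_def risk_def by (intro integral_mono) auto
qed

end
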